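(* Let $\pi$ be a deterministic broadcast protocol (in the radio network model described in the context) whose number of rounds $r(n)$ on networks with parameter $n$ satisfies $r(n) = o(\sqrt{n})$. Then (for all sufficiently large $n$) there exists a $C_2$ network $N$ such that $\pi$ does not complete broadcast within $r(n)$ rounds when executed on $N$. In other words, every deterministic broadcast protocol needs $\Omega(\sqrt{n})$ rounds on some $C_2$ network (a network of radius $2$).
   Context: Radio network model: the network is an undirected connected graph whose vertices (nodes) are processors with distinct labels from $\{0,1,\dots,m\}$, $m$ polynomial in the number of nodes; the node with label $0$ is the source, which holds a broadcast message. Computation proceeds in synchronous rounds $0,1,2,\dots$; all nodes run identical copies of the same deterministic protocol. In each round each node either transmits, receives, or is inactive. A node receives a message in a round if and only if it acts as a receiver and exactly one of its neighbours transmits in that round; otherwise it receives $\phi$ (no distinction between silence and collision). Messages are authenticated (the receiver learns the label of the sender). The action of a node in a round is determined by its initial input (its own label and the labels of its neighbours) and the messages it received in previous rounds. In round $0$ only the source transmits (the broadcast message). Only nodes that have already received a message may transmit (the only spontaneous transmission is the source's in round $0$). Broadcast is completed in $r$ rounds if every node receives the source message in one of the rounds $0,1,\dots,r-1$. $C_2$ networks (for $n$ a perfect square): the nodes are partitioned into layers $L_0,L_1,L_2$. $L_0$ consists only of the source. $L_1$ consists of $\sqrt{n}$ groups of $\sqrt{n}$ nodes each, all connected to the source. $L_2$ consists of $\sqrt{n}$ nodes, each associated with a distinct group of $L_1$ and connected to an arbitrary subset of the nodes of that group (no other edges). A group of $L_1$ together with its associated $L_2$ node is a (BGI-)component. The node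 labels are fixed and the same for all $C_2$ networks, so $C_2$ networks differ only in the edge sets between the $L_2$ nodes and their groups. *)

theory Defs
  imports Complex_Main "HOL-Library.Landau_Symbols" "HOL-Library.Disjoint_Sets"
begin

text \<open>
  Nodes are identified with their (distinct) labels; the source is \<open>0\<close>. An undirected graph is a
  symmetric, irreflexive relation \<open>E\<close> on \<open>V\<close>. The function \<open>m\<close> bounds the labels in terms of the
  number of nodes.
\<close>

definition radio_network :: "(nat \<Rightarrow> nat) \<Rightarrow> nat set \<Rightarrow> nat rel \<Rightarrow> bool" where
  "radio_network m V E \<longleftrightarrow>
     V \<subseteq> {0..m (card V)} \<and> 0 \<in> V \<and> E \<subseteq> V \<times> V \<and> sym E \<and> irrefl E \<and>
     (\<forall>u\<in>V. \<forall>v\<in>V. (u, v) \<in> E\<^sup>*)"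

definition poly_bounded :: "(nat \<Rightarrow> nat) \<Rightarrow> bool" where
  "poly_bounded m \<longleftrightarrow> (\<exists>d::nat. (\<lambda>N. real (m N)) \<in> O(\<lambda>N. real N ^ d))"

definition gdist :: "nat rel \<Rightarrow> nat \<Rightarrow> nat \<Rightarrow> nat" where
  "gdist E u v = (LEAST d. (u, v) \<in> E ^^ d)"

definition graph_radius :: "nat set \<Rightarrow> nat rel \<Rightarrow> nat" where
  "graph_radius V E = Min ((\<lambda>u. Max (gdist E u ` V)) ` V)"

text \<open>
  A transmitted message is a list of items of an arbitrary type; the source message is one such
  item \<open>\<mu>\<close>, which may be sent along with any other information.
\<close>

datatype 'a action = is_Transmit: Transmit (msg_of: "'a list") | Receive | Inactive

text \<open>
  The history of a node before round \<open>t\<close> is the list of what it got in rounds \<open>0, \<dots>, t - 1\<close>: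
  \<open>None\<close> stands for \<open>\<phi>\<close>, and \<open>Some (w, M)\<close> for message \<open>M\<close> from the sender with label \<open>w\<close>.
  A protocol maps a node's label, the labels of its neighbours, and its history to an action.
\<close>

type_synonym 'a history = "(nat \<times> 'a list) option list"
type_synonym 'a protocol = "nat \<Rightarrow> nat set \<Rightarrow> 'a history \<Rightarrow> 'a action"

definition broadcast_protocol :: "'a \<Rightarrow> 'a protocol \<Rightarrow> bool" where
  "broadcast_protocol \<mu> \<pi> \<longleftrightarrow>
     (\<forall>A. \<pi> 0 A [] = Transmit [\<mu>]) \<and>
     (\<forall>v A h. (\<forall>x\<in>set h. x = None) \<and> \<not> (v = 0 \<and> h = []) \<longrightarrow> \<not> is_Transmit (\<pi> v A h))"

definition reception :: "nat rel \<Rightarrow> (nat \<Rightarrow> 'a action) \<Rightarrow> nat \<Rightarrow> (nat \<times> 'a list) option" where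
  "reception E act v =
     (if act v = Receive \<and> (\<exists>!w. w \<in> E `` {v} \<and> is_Transmit (act w))
      then (let w = (THE w. w \<in> E `` {v} \<and> is_Transmit (act w)) in Some (w, msg_of (act w)))
      else None)"

fun history :: "'a protocol \<Rightarrow> nat rel \<Rightarrow> nat \<Rightarrow> nat \<Rightarrow> 'a history" where
  "history \<pi> E 0 v = []"
| "history \<pi> E (Suc t) v =
     history \<pi> E t v @ [reception E (\<lambda>w. \<pi> w (E `` {w}) (history \<pi> E t w)) v]"

definition received :: "'a protocol \<Rightarrow> nat rel \<Rightarrow> nat \<Rightarrow> nat \<Rightarrow> (nat \<times> 'a list) option" where
  "received \<pi> E t v = reception E (\<lambda>w. \<pi> w (E `` {w}) (history \<pi> E t w)) v"

text \<open>The source holds \<open>\<mu>\<close> from the start, so it is not required to receive it.\<close>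

definition completes_broadcast ::
    "'a \<Rightarrow> 'a protocol \<Rightarrow> nat set \<Rightarrow> nat rel \<Rightarrow> nat \<Rightarrow> bool" where
  "completes_broadcast \<mu> \<pi> V E r \<longleftrightarrow>
     (\<forall>v\<in>V - {0}. \<exists>t<r. \<exists>w M. received \<pi> E t v = Some (w, M) \<and> \<mu> \<in> set M)"

text \<open>
  In the following, \<open>n = k\<^sup>2\<close>. The groups of the first layer are \<open>G i\<close>, and \<open>z i\<close> is the node of
  the second layer associated with \<open>G i\<close>, for \<open>i < k\<close>. The pair \<open>(G, z)\<close> is the fixed labelling
  shared by all \<open>C\<^sub>2\<close> networks with the same \<open>n\<close>.
\<close>

definition C2_nodes :: "nat \<Rightarrow> (nat \<Rightarrow> nat set) \<Rightarrow> (nat \<Rightarrow> nat) \<Rightarrow> nat set" where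
  "C2_nodes k G z = {0} \<union> (\<Union>i<k. G i) \<union> z ` {..<k}"

definition C2_labelling ::
    "(nat \<Rightarrow> nat) \<Rightarrow> nat \<Rightarrow> (nat \<Rightarrow> nat set) \<Rightarrow> (nat \<Rightarrow> nat) \<Rightarrow> bool" where
  "C2_labelling m k G z \<longleftrightarrow>
     (\<forall>i<k. finite (G i) \<and> card (G i) = k \<and> 0 \<notin> G i) \<and>
     disjoint_family_on G {..<k} \<and>
     inj_on z {..<k} \<and> 0 \<notin> z ` {..<k} \<and> (\<forall>i<k. \<forall>j<k. z i \<notin> G j) \<and>
     C2_nodes k G z \<subseteq> {0..m (card (C2_nodes k G z))}"

definition C2_edges :: "nat \<Rightarrow> (nat \<Rightarrow> nat set) \<Rightarrow> (nat \<Rightarrow> nat) \<Rightarrow> (nat \<Rightarrow> nat set) \<Rightarrow> nat rel" where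
  "C2_edges k G z S =
     (let D = {0} \<times> (\<Union>i<k. G i) \<union> (\<Union>i<k. {z i} \<times> S i) in D \<union> D\<inverse>)"

text \<open>Connectedness, part of \<open>radio_network\<close>, excludes exactly the case of an empty \<open>S i\<close>.\<close>

definition C2_network ::
    "(nat \<Rightarrow> nat) \<Rightarrow> nat \<Rightarrow> (nat \<Rightarrow> nat set) \<Rightarrow> (nat \<Rightarrow> nat) \<Rightarrow> nat set \<Rightarrow> nat rel \<Rightarrow> bool" where
  "C2_network m k G z V E \<longleftrightarrow>
     radio_network m V E \<and> V = C2_nodes k G z \<and>
     (\<exists>S. (\<forall>i<k. S i \<subseteq> G i) \<and> E = C2_edges k G z S)"

end

theory Submission
  imports Defs
begin

text \<open>
  The components of a \<open>C\<^sub>2\<close> network interact only through the source, so the behaviour of a component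
  is determined by its own edges and by what the source has heard. An adversary fixes at most two
  components per round so that the reception of the source in that round no longer depends on the
  others: if two components that are still free can be made to transmit to the source in this round,
  it fixes both accordingly and the source sees a collision; otherwise all free components but at
  most one are silent whatever their edges are, and it fixes that one. After \<open>k div 3\<close> rounds a
  component is still free. Its nodes have heard nothing but the source, so the sets of those that
  want to transmit are predetermined, and since there are fewer than \<open>k\<close> such sets there is a
  nonempty set of neighbours of the second-layer node that meets none of them in exactly one point.
\<close>

section \<open>Sets that no member of a small family meets in exactly one point\<close>

text \<open>Greedy deletion: if some \<open>T t\<close> meets \<open>A\<close> in a single point,
  drop that point from \<open>A\<close> and \<open>t\<close> from \<open>I\<close>. No subset of
  what remains meets \<open>T t\<close> at all, so \<open>t\<close> stays harmless. Each deletion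
  costs one point and one index, so the strict inequality survives and the final set is
  nonempty.\<close>

lemma exists_unselected_subset:
  fixes T :: "'b \<Rightarrow> 'c set"
  assumes "finite I" "finite A" "card I < card A"
  shows "\<exists>X\<subseteq>A. X \<noteq> {} \<and> (\<forall>t\<in>I. \<not> (\<exists>!x. x \<in> X \<and> x \<in> T t))"
  using assms
proof (induction "card I" arbitrary: I A)
  case 0
  then show ?case by (intro exI[of _ A]) auto
next
  case (Suc n)
  show ?case
  proof (cases "\<exists>t\<in>I. \<exists>!x. x \<in> A \<and> x \<in> T t")
    case False
    with Suc.prems show ?thesis by (intro exI[of _ A]) auto
  next
    case True
    then obtain t x where t: "t \<in> I" and x: "x \<in> A" "x \<in> T t"
      and uniq: "\<And>y. y \<in> A \<Longrightarrow> y \<in> T t \<Longrightarrow> y = x" by blast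
    have "n = card (I - {t})" using Suc.hyps(2) t Suc.prems(1) by simp
    moreover have "card (I - {t}) < card (A - {x})"
      using Suc.prems t x Suc.hyps(2) by simp
    ultimately obtain X where X: "X \<subseteq> A - {x}" "X \<noteq> {}"
      "\<forall>s\<in>I - {t}. \<not> (\<exists>!y. y \<in> X \<and> y \<in> T s)"
      using Suc.hyps(1)[of "I - {t}" "A - {x}"] Suc.prems by auto
    have "\<not> (\<exists>y. y \<in> X \<and> y \<in> T t)" using X(1) uniq by blast
    with X show ?thesis by (intro exI[of _ X]) blast
  qed
qed

section \<open>Reception in one round, and histories\<close>

text \<open>Reception depends only on which neighbours transmit and what they send. Neighbours that
  are silent in both runs may therefore act differently (\<open>Receive\<close> against
  \<open>Inactive\<close>); the adversary argument needs this slack for the components not yet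
  fixed.\<close>

lemma reception_cong:
  assumes "E `` {v} = E' `` {v}" "act v = act' v"
    and "\<And>w. w \<in> E `` {v} \<Longrightarrow> act w = act' w \<or> \<not> is_Transmit (act w) \<and> \<not> is_Transmit (act' w)"
  shows "reception E act v = reception E' act' v"
proof -
  have eq: "(w \<in> E `` {v} \<and> is_Transmit (act w)) = (w \<in> E' `` {v} \<and> is_Transmit (act' w))" for w
    using assms by metis
  show ?thesis
  proof (cases "act v = Receive \<and> (\<exists>!w. w \<in> E `` {v} \<and> is_Transmit (act w))")
    case True
    define w where "w = (THE w. w \<in> E `` {v} \<and> is_Transmit (act w))"
    have "w \<in> E `` {v} \<and> is_Transmit (act w)"
      unfolding w_def by (rule theI') (use True in blast)
    hence "act w = act' w" using assms(3) by blast
    then show ?thesis using True assms(2)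
      unfolding reception_def eq[symmetric] w_def[symmetric] by (simp add: Let_def)
  next
    case False
    then show ?thesis using assms(2) unfolding reception_def eq by auto
  qed
qed

lemma reception_eq_None_if_collision:
  assumes "x \<in> E `` {v}" "y \<in> E `` {v}" "x \<noteq> y" "is_Transmit (act x)" "is_Transmit (act y)"
  shows "reception E act v = None"
  unfolding reception_def using assms by (auto simp: Ex1_def)

text \<open>Meant for a first-layer node whose second-layer neighbour is silent: the source is then
  the only possible sender.\<close>

lemma reception_single_sender:
  assumes "w \<in> E `` {v}" "\<And>u. u \<in> E `` {v} \<Longrightarrow> u \<noteq> w \<Longrightarrow> \<not> is_Transmit (act u)"
  shows "reception E act v =
    (if act v = Receive \<and> is_Transmit (act w) then Some (w, msg_of (act w)) else None)"
proof (cases "is_Transmit (act w)")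
  case True
  with assms have "(THE u. u \<in> E `` {v} \<and> is_Transmit (act u)) = w"
    by (intro the_equality) auto
  moreover have "\<exists>!u. u \<in> E `` {v} \<and> is_Transmit (act u)"
    using True assms by blast
  ultimately show ?thesis using True by (simp add: reception_def Let_def)
next
  case False
  with assms have "\<not> (\<exists>!u. u \<in> E `` {v} \<and> is_Transmit (act u))" by metis
  then show ?thesis using False by (simp add: reception_def del: Image_singleton_iff)
qed

lemma uninformed_silent:
  assumes "broadcast_protocol \<mu> \<pi>" "\<forall>x\<in>set h. x = None" "v \<noteq> 0"
  shows "\<not> is_Transmit (\<pi> v A h)"
  using assms unfolding broadcast_protocol_def by simp

lemma length_history [simp]: "length (history \<pi> E t v) = t"
  by (induction t) auto

lemma take_history: "s \<le> t \<Longrightarrow> take s (history \<pi> E t v) = history \<pi> E s v"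
proof (induction t)
  case (Suc t)
  then show ?case by (cases "s = Suc t") auto
qed simp

lemma history_eq_mono:
  assumes "history \<pi> E t v = history \<pi> E' t v" "s \<le> t"
  shows "history \<pi> E s v = history \<pi> E' s v"
  using assms take_history by metis

text \<open>The predicted history of a node with neighbours \<open>A\<close> when only the source,
  acting as \<open>a\<close>, is ever heard. No edge relation occurs in it, so it can be evaluated
  before the edges of the component are chosen.\<close>

fun history_source_only :: "'a protocol \<Rightarrow> (nat \<Rightarrow> 'a action) \<Rightarrow> nat set \<Rightarrow> nat \<Rightarrow> nat \<Rightarrow> 'a history" where
  "history_source_only \<pi> a A 0 v = []"
| "history_source_only \<pi> a A (Suc t) v = history_source_only \<pi> a A t v @
     [if \<pi> v A (history_source_only \<pi> a A t v) = Receive \<and> is_Transmit (a t)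
      then Some (0, msg_of (a t)) else None]"

section \<open>Structure of \<open>C2\<close> networks with a fixed labelling\<close>

locale C2_family =
  fixes m :: "nat \<Rightarrow> nat" and k :: nat and G :: "nat \<Rightarrow> nat set" and z :: "nat \<Rightarrow> nat"
  assumes labelling: "C2_labelling m k G z"
begin

abbreviation edges :: "(nat \<Rightarrow> nat set) \<Rightarrow> nat rel" where
  "edges \<equiv> C2_edges k G z"

definition valid :: "(nat \<Rightarrow> nat set) \<Rightarrow> bool" where
  "valid S \<longleftrightarrow> (\<forall>i<k. S i \<subseteq> G i \<and> S i \<noteq> {})"

lemma valid_update: "valid S \<Longrightarrow> X \<subseteq> G i \<Longrightarrow> X \<noteq> {} \<Longrightarrow> valid (S(i := X))"
  by (auto simp: valid_def)

lemma group: "i < k \<Longrightarrow> finite (G i) \<and> card (G i) = k \<and> 0 \<notin> G i"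
  using labelling by (auto simp: C2_labelling_def)

lemma group_disjoint: "i < k \<Longrightarrow> j < k \<Longrightarrow> x \<in> G i \<Longrightarrow> x \<in> G j \<Longrightarrow> i = j"
  using labelling by (auto simp: C2_labelling_def disjoint_family_on_def)

lemma z_inj: "i < k \<Longrightarrow> j < k \<Longrightarrow> z i = z j \<Longrightarrow> i = j"
  using labelling by (auto simp: C2_labelling_def inj_on_def)

lemma z_nonzero: "i < k \<Longrightarrow> z i \<noteq> 0"
  using labelling by (force simp: C2_labelling_def)

lemma z_notin: "i < k \<Longrightarrow> j < k \<Longrightarrow> z i \<notin> G j"
  using labelling by (auto simp: C2_labelling_def)

lemma C2_nodes_cases:
  assumes "v \<in> C2_nodes k G z"
  obtains (1) "v = 0" | (2) i where "i < k" "v \<in> G i" | (3) i where "i < k" "v = z i"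
  using assms unfolding C2_nodes_def by blast

lemma edges_iff:
  "(u, v) \<in> edges S \<longleftrightarrow>
     u = 0 \<and> (\<exists>i<k. v \<in> G i) \<or> v = 0 \<and> (\<exists>i<k. u \<in> G i) \<or>
     (\<exists>i<k. u = z i \<and> v \<in> S i) \<or> (\<exists>i<k. v = z i \<and> u \<in> S i)"
  by (auto simp: C2_edges_def Let_def)

lemma sym_edges: "sym (edges S)"
  by (auto simp: sym_def edges_iff)

lemma neighbours_source:
  assumes "valid S" shows "edges S `` {0} = (\<Union>i<k. G i)"
proof -
  have "0 \<notin> S i" "0 \<noteq> z i" "0 \<notin> G i" if "i < k" for i
    using assms group[OF that] z_nonzero[OF that] that unfolding valid_def by auto
  then show ?thesis unfolding set_eq_iff Image_singleton_iff edges_iff UN_iff by (metis lessThan_iff)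
qed

lemma neighbours_group:
  assumes "valid S" "i < k" "x \<in> G i"
  shows "edges S `` {x} = (if x \<in> S i then {0, z i} else {0})"
proof -
  have "x \<noteq> 0" using group[OF assms(2)] assms(3) by metis
  moreover have "x \<noteq> z j" if "j < k" for j using z_notin assms that by metis
  moreover have "j = i" if "j < k" "x \<in> S j" for j
    using that assms group_disjoint unfolding valid_def by blast
  ultimately have "(x, v) \<in> edges S \<longleftrightarrow> v = 0 \<or> v = z i \<and> x \<in> S i" for v
    unfolding edges_iff using assms(2,3) by metis
  then show ?thesis by auto
qed

lemma neighbours_z:
  assumes "valid S" "i < k"
  shows "edges S `` {z i} = S i"
proof -
  have "z i \<noteq> 0" "\<And>j. j < k \<Longrightarrow> z i \<notin> G j" "\<And>j. j < k \<Longrightarrow> z i = z j \<Longrightarrow> j = i"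
    using z_nonzero z_notin z_inj assms by auto
  moreover have "z i \<notin> S j" if "j < k" for j
    using assms that z_notin unfolding valid_def by blast
  ultimately have "(z i, v) \<in> edges S \<longleftrightarrow> v \<in> S i" for v
    unfolding edges_iff using assms(2) by metis
  then show ?thesis by auto
qed

lemma radio_network_edges:
  assumes "valid S" shows "radio_network m (C2_nodes k G z) (edges S)"
proof -
  have to0: "(0, u) \<in> (edges S)\<^sup>*" if "u \<in> C2_nodes k G z" for u
  proof -
    from that show ?thesis
    proof (cases rule: C2_nodes_cases)
      case (2 i)
      then show ?thesis by (intro r_into_rtrancl) (auto simp: edges_iff)
    next
      case (3 i)
      then obtain x where x: "x \<in> S i" "x \<in> G i" using assms unfolding valid_def by blast
      have "(0, x) \<in> edges S" "(x, u) \<in> edges S" using 3 x by (auto simp: edges_iff)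
      then show ?thesis by (meson r_into_rtrancl rtrancl_trans)
    qed simp
  qed
  have "(u, v) \<in> (edges S)\<^sup>*" if "u \<in> C2_nodes k G z" "v \<in> C2_nodes k G z" for u v
    using to0[OF that(1)] to0[OF that(2)] sym_rtrancl[OF sym_edges]
    by (meson rtrancl_trans symD)
  moreover have "C2_nodes k G z \<subseteq> {0..m (card (C2_nodes k G z))}"
    using labelling by (simp add: C2_labelling_def)
  moreover have "edges S \<subseteq> C2_nodes k G z \<times> C2_nodes k G z"
  proof -
    have "0 \<in> C2_nodes k G z" by (simp add: C2_nodes_def)
    moreover have "z i \<in> C2_nodes k G z" "G i \<subseteq> C2_nodes k G z" "S i \<subseteq> C2_nodes k G z" if "i < k" for i
      using that assms unfolding C2_nodes_def valid_def by blast+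
    ultimately show ?thesis unfolding subset_iff by (auto simp: edges_iff)
  qed
  moreover have "irrefl (edges S)"
    using assms group z_notin unfolding irrefl_def edges_iff valid_def by blast
  ultimately show ?thesis
    by (auto simp: radio_network_def sym_edges C2_nodes_def)
qed

lemma C2_network_edges:
  assumes "valid S" shows "C2_network m k G z (C2_nodes k G z) (edges S)"
  using radio_network_edges[OF assms] assms unfolding C2_network_def valid_def by blast

section \<open>Distances and radius\<close>

text \<open>Reachability ensures that the \<open>LEAST\<close> in \<open>gdist\<close> is attained;
  the other two assumptions rule out the values 0 and 1.\<close>

lemma gdist_ge_2:
  assumes "(u, v) \<in> (edges S)\<^sup>*" "u \<noteq> v" "(u, v) \<notin> edges S"
  shows "2 \<le> gdist (edges S) u v"
proof -
  obtain d where "(u, v) \<in> edges S ^^ d" using assms(1) by (auto simp: rtrancl_is_UN_relpow)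
  hence *: "(u, v) \<in> edges S ^^ gdist (edges S) u v" unfolding gdist_def by (rule LeastI)
  have "gdist (edges S) u v \<noteq> 0" using * assms(2) by (metis relpow_0_E)
  moreover have "gdist (edges S) u v \<noteq> 1" using * assms(3) by auto
  ultimately show ?thesis by linarith
qed

lemma gdist_source_le_2:
  assumes "valid S" "v \<in> C2_nodes k G z"
  shows "gdist (edges S) 0 v \<le> 2"
proof -
  have "\<exists>d\<le>2. (0, v) \<in> edges S ^^ d"
  proof -
    from assms(2) show ?thesis
    proof (cases rule: C2_nodes_cases)
      case 1
      then show ?thesis by (intro exI[of _ 0]) auto
    next
      case (2 i)
      then show ?thesis by (intro exI[of _ 1]) (auto simp: edges_iff)
    next
      case (3 i)
      then obtain x where x: "x \<in> S i" "x \<in> G i" using assms unfolding valid_def by blast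
      have "(0, x) \<in> edges S" "(x, v) \<in> edges S" using 3 x by (auto simp: edges_iff)
      then show ?thesis by (intro exI[of _ 2]) (auto simp: numeral_2_eq_2)
    qed
  qed
  then obtain d where "d \<le> 2" "(0, v) \<in> edges S ^^ d" by blast
  then show ?thesis unfolding gdist_def by (meson Least_le order_trans)
qed

text \<open>The source has eccentricity at most 2, and every node has some other node that is not
  adjacent to it. For a node of a group this is the second-layer node of another component, which
  exists because \<open>2 \<le> k\<close>.\<close>

lemma graph_radius_edges:
  assumes "valid S" "2 \<le> k"
  shows "graph_radius (C2_nodes k G z) (edges S) = 2"
proof -
  let ?V = "C2_nodes k G z" and ?E = "edges S"
  have fin: "finite ?V" using group by (auto simp: C2_nodes_def)
  have conn: "(u, v) \<in> ?E\<^sup>*" if "u \<in> ?V" "v \<in> ?V" for u v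
    using radio_network_edges[OF assms(1)] that by (auto simp: radio_network_def)
  have far: "\<exists>v\<in>?V. 2 \<le> gdist ?E u v" if u: "u \<in> ?V" for u
  proof -
    have "\<exists>v\<in>?V. u \<noteq> v \<and> (u, v) \<notin> ?E"
    proof -
      from u show ?thesis
      proof (cases rule: C2_nodes_cases)
        case 1
        have "0 < k" using assms(2) by simp
        moreover have "z 0 \<notin> ?E `` {0}"
          using neighbours_source[OF assms(1)] z_notin[OF \<open>0 < k\<close>] by auto
        ultimately show ?thesis using 1 z_nonzero[of 0]
          by (intro bexI[of _ "z 0"]) (auto simp: C2_nodes_def)
      next
        case (2 i)
        define j where "j = (if i = 0 then 1 else 0 :: nat)"
        have j: "j < k" "j \<noteq> i" using assms(2) by (auto simp: j_def)
        have "z j \<notin> ?E `` {u}"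
          using neighbours_group[OF assms(1) 2] z_nonzero z_inj 2 j by auto
        moreover have "u \<noteq> z j" using z_notin j 2 by metis
        ultimately show ?thesis using j
          by (intro bexI[of _ "z j"]) (auto simp: C2_nodes_def)
      next
        case (3 i)
        have "0 \<notin> ?E `` {u}"
          using neighbours_z[OF assms(1) 3(1)] 3 assms(1) group unfolding valid_def by auto
        then show ?thesis using 3 z_nonzero
          by (intro bexI[of _ 0]) (auto simp: C2_nodes_def)
      qed
    qed
    then show ?thesis using gdist_ge_2 conn u by blast
  qed
  have src: "0 \<in> ?V" by (simp add: C2_nodes_def)
  have ge: "2 \<le> Max (gdist ?E u ` ?V)" if "u \<in> ?V" for u
    using far[OF that] fin by (meson Max_ge dual_order.trans finite_imageI imageI)
  have "Max (gdist ?E 0 ` ?V) \<le> 2"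
    using gdist_source_le_2[OF assms(1)] fin src by (subst Max_le_iff) auto
  with ge[OF src] have "Max (gdist ?E 0 ` ?V) = 2" by simp
  with ge fin src show ?thesis unfolding graph_radius_def by (intro Min_eqI) force+
qed

section \<open>Executions: components interact only through the source\<close>

context
  fixes \<pi> :: "'a protocol"
begin

abbreviation hist :: "(nat \<Rightarrow> nat set) \<Rightarrow> nat \<Rightarrow> nat \<Rightarrow> 'a history" where
  "hist S \<equiv> history \<pi> (edges S)"

abbreviation act :: "(nat \<Rightarrow> nat set) \<Rightarrow> nat \<Rightarrow> nat \<Rightarrow> 'a action" where
  "act S t v \<equiv> \<pi> v (edges S `` {v}) (hist S t v)"

lemma act_source_cong:
  assumes "valid S" "valid S'" "hist S t 0 = hist S' t 0"
  shows "act S t 0 = act S' t 0"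
  using assms by (simp add: neighbours_source)

text \<open>The only neighbour of a component outside it is the source. The source has the same
  neighbours in every valid network, so equal histories make it act equally, and induction on rounds
  carries this over to the component.\<close>

lemma component_determined_by_source:
  assumes "valid S" "valid S'" "i < k" "S i = S' i" "hist S t 0 = hist S' t 0"
    and "v \<in> insert (z i) (G i)"
  shows "hist S t v = hist S' t v"
  using assms(5,6)
proof (induction t arbitrary: v)
  case (Suc t)
  have src: "hist S t 0 = hist S' t 0" using Suc.prems(1) by simp
  have nb: "edges S `` {w} = edges S' `` {w}" if "w \<in> insert (z i) (G i)" for w
    using that assms(1-4) by (metis insert_iff neighbours_group neighbours_z)
  have act: "act S t w = act S' t w" if "w \<in> insert 0 (insert (z i) (G i))" for w
    using that Suc.IH[OF src] nb act_source_cong[OF assms(1,2) src] by auto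
  have "edges S `` {v} \<subseteq> insert 0 (insert (z i) (G i))"
  proof (cases "v = z i")
    case True
    then show ?thesis using neighbours_z[OF assms(1,3)] assms(1,3) unfolding valid_def by blast
  next
    case False
    then show ?thesis using neighbours_group[OF assms(1,3)] Suc.prems(2) by simp
  qed
  then have "reception (edges S) (act S t) v = reception (edges S') (act S' t) v"
    using nb[OF Suc.prems(2)] act Suc.prems(2) by (intro reception_cong) blast+
  then show ?case using Suc.IH[OF src Suc.prems(2)] by simp
qed simp

lemma group_act_cong:
  assumes "valid S" "valid S'" "i < k" "S i = S' i" "hist S t 0 = hist S' t 0" "v \<in> G i"
  shows "act S t v = act S' t v"
proof -
  have "hist S t v = hist S' t v" using component_determined_by_source[OF assms(1-5)] assms(6) by blast
  moreover have "edges S `` {v} = edges S' `` {v}" using assms by (simp add: neighbours_group)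
  ultimately show ?thesis by simp
qed

section \<open>The adversary\<close>

text \<open>The invariant of the adversary: \<open>C\<close> collects the components already fixed.
  The nodes of the others may still behave differently in different \<open>S'\<close>; only what the
  source hears before round \<open>t\<close> must coincide.\<close>

definition forces_source :: "nat \<Rightarrow> nat set \<Rightarrow> (nat \<Rightarrow> nat set) \<Rightarrow> bool" where
  "forces_source t C S \<longleftrightarrow>
     (\<forall>S'. valid S' \<and> (\<forall>i\<in>C. S' i = S i) \<longrightarrow> hist S' t 0 = hist S t 0)"

lemma forces_source_step:
  assumes "valid S" "C \<subseteq> {..<k}" "card C \<le> 2 * t" "forces_source t C S"
  shows "\<exists>C' S'. valid S' \<and> C' \<subseteq> {..<k} \<and> card C' \<le> 2 * Suc t \<and> forces_source (Suc t) C' S'"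
proof -
  \<comment> \<open>For \<open>i \<notin> C\<close> the base \<open>S\<close> is only a reference:
    component \<open>i\<close> with edges \<open>X\<close> acts the same in every valid network that
    agrees with \<open>S\<close> on \<open>C\<close>. All of \<open>G i\<close> counts, not just
    \<open>X\<close>, since the source is adjacent to the whole group.\<close>
  define loud where "loud i X \<longleftrightarrow> X \<subseteq> G i \<and> X \<noteq> {} \<and> (\<exists>x\<in>G i. is_Transmit (act (S(i := X)) t x))" for i X
  define L where "L = {i. i < k \<and> i \<notin> C \<and> (\<exists>X. loud i X)}"
  have finC: "finite C" using assms(2) finite_subset by blast
  have src: "hist S1 t 0 = hist S2 t 0"
    if "valid S1" "valid S2" "\<forall>i\<in>C. S1 i = S i" "\<forall>i\<in>C. S2 i = S i" for S1 S2
    using assms(4) that unfolding forces_source_def by metis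
  show ?thesis
  proof (cases "\<exists>i j. i \<in> L \<and> j \<in> L \<and> i \<noteq> j")
    case True
    then obtain i j X Y where ij: "i < k" "j < k" "i \<notin> C" "j \<notin> C" "i \<noteq> j" "loud i X" "loud j Y"
      unfolding L_def by blast
    define S1 where "S1 = S(i := X, j := Y)"
    define C1 where "C1 = insert i (insert j C)"
    have S1: "valid S1" using ij assms(1) unfolding S1_def loud_def by (intro valid_update) auto
    have None: "reception (edges S') (act S' t) 0 = None"
      if v: "valid S'" and ag: "\<forall>l\<in>C1. S' l = S1 l" for S'
    proof -
      have agC: "\<forall>l\<in>C. S' l = S l" using ag ij unfolding S1_def C1_def by auto
      obtain x where x: "x \<in> G i" "is_Transmit (act (S(i := X)) t x)" using ij unfolding loud_def by blast
      obtain y where y: "y \<in> G j" "is_Transmit (act (S(j := Y)) t y)" using ij unfolding loud_def by blast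
      have vX: "valid (S(i := X))" and vY: "valid (S(j := Y))"
        using ij assms(1) unfolding loud_def by (auto intro: valid_update)
      \<comment> \<open>Both networks agree with \<open>S\<close> on \<open>C\<close>, so the source
        has the same history in them and the transmission that makes \<open>X\<close> loud also
        occurs in \<open>S'\<close>.\<close>
      have "act S' t x = act (S(i := X)) t x"
      proof (rule group_act_cong[OF v vX ij(1) _ _ x(1)])
        show "S' i = (S(i := X)) i" using ag ij unfolding C1_def S1_def by auto
        show "hist S' t 0 = hist (S(i := X)) t 0" using ij agC by (intro src v vX) auto
      qed
      moreover have "act S' t y = act (S(j := Y)) t y"
      proof (rule group_act_cong[OF v vY ij(2) _ _ y(1)])
        show "S' j = (S(j := Y)) j" using ag ij unfolding C1_def S1_def by auto
        show "hist S' t 0 = hist (S(j := Y)) t 0" using ij agC by (intro src v vY) auto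
      qed
      moreover have "x \<noteq> y" using x y ij group_disjoint by blast
      moreover have "x \<in> edges S' `` {0}" "y \<in> edges S' `` {0}"
        unfolding neighbours_source[OF v] using x y ij by auto
      ultimately show ?thesis
        using x y by (intro reception_eq_None_if_collision[of x _ _ y]) auto
    qed
    have "forces_source (Suc t) C1 S1"
      unfolding forces_source_def
    proof (intro allI impI)
      fix S' assume S': "valid S' \<and> (\<forall>l\<in>C1. S' l = S1 l)"
      have "hist S' t 0 = hist S1 t 0"
        using S' S1 ij by (intro src) (auto simp: C1_def S1_def)
      then show "hist S' (Suc t) 0 = hist S1 (Suc t) 0" using None[of S'] None[of S1] S' S1 by simp
    qed
    moreover have "card C1 \<le> 2 * Suc t"
      using assms(3) finC unfolding C1_def by (simp add: card_insert_if)
    moreover have "C1 \<subseteq> {..<k}" using ij assms(2) unfolding C1_def by auto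
    ultimately show ?thesis using S1 by blast
  next
    case False
    \<comment> \<open>\<open>L\<close> may also be empty; then any \<open>l\<close> will do.\<close>
    then obtain l where l: "L \<subseteq> {l}" by blast
    define C1 where "C1 = C \<union> L"
    have "card L \<le> 1" using card_mono[OF _ l] by simp
    then have "card C1 \<le> 2 * Suc t" using card_Un_le[of C L] assms(3) unfolding C1_def by simp
    moreover have "forces_source (Suc t) C1 S"
      unfolding forces_source_def
    proof (intro allI impI)
      fix S' assume "valid S' \<and> (\<forall>i\<in>C1. S' i = S i)"
      then have v: "valid S'" and ag: "\<forall>i\<in>C1. S' i = S i" by auto
      \<comment> \<open>Stated for an arbitrary \<open>S2\<close> because it is applied to both
        \<open>S'\<close> and \<open>S\<close>, whose edges in component \<open>i\<close> may
        differ.\<close>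
      have silent: "\<not> is_Transmit (act S2 t x)"
        if S2: "valid S2" "\<forall>i\<in>C. S2 i = S i" and i: "i < k" "i \<notin> C1" "x \<in> G i" for S2 i x
      proof -
        have vu: "valid (S(i := S2 i))" using S2 i assms(1) by (intro valid_update) (auto simp: valid_def)
        have "act S2 t x = act (S(i := S2 i)) t x"
        proof (rule group_act_cong[OF S2(1) vu i(1) _ _ i(3)])
          show "hist S2 t 0 = hist (S(i := S2 i)) t 0"
            using S2 i by (intro src S2 vu) (auto simp: C1_def)
        qed simp
        moreover have "\<not> loud i (S2 i)" using i unfolding C1_def L_def by blast
        then have "\<not> is_Transmit (act (S(i := S2 i)) t x)"
          using S2(1) i unfolding loud_def valid_def by blast
        ultimately show ?thesis by simp
      qed
      have agC: "\<forall>i\<in>C. S' i = S i" using ag by (auto simp: C1_def)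
      have h: "hist S' t 0 = hist S t 0" using src[OF v assms(1) agC] by simp
      have "reception (edges S') (act S' t) 0 = reception (edges S) (act S t) 0"
      proof (rule reception_cong)
        show "edges S' `` {0} = edges S `` {0}" using v assms(1) by (simp add: neighbours_source)
        show "act S' t 0 = act S t 0" by (rule act_source_cong[OF v assms(1) h])
        fix w assume "w \<in> edges S' `` {0}"
        then obtain i where i: "i < k" "w \<in> G i" unfolding neighbours_source[OF v] by blast
        show "act S' t w = act S t w \<or> \<not> is_Transmit (act S' t w) \<and> \<not> is_Transmit (act S t w)"
        proof (cases "i \<in> C1")
          case True
          then show ?thesis using group_act_cong[OF v assms(1) i(1) _ h i(2)] ag by blast
        next
          case False
          then show ?thesis using silent[OF v agC i(1) False i(2)]
            silent[OF assms(1) _ i(1) False i(2)] by blast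
        qed
      qed
      then show "hist S' (Suc t) 0 = hist S (Suc t) 0" using h by simp
    qed
    moreover have "C1 \<subseteq> {..<k}" using assms(2) unfolding C1_def L_def by auto
    ultimately show ?thesis using assms(1) by blast
  qed
qed

lemma exists_forces_source:
  "\<exists>C S. valid S \<and> C \<subseteq> {..<k} \<and> card C \<le> 2 * t \<and> forces_source t C S"
proof (induction t)
  case 0
  \<comment> \<open>The initial network joins each second-layer node to its whole group.\<close>
  have "G i \<noteq> {}" if "i < k" for i using group[OF that] that by auto
  then have "valid G" by (auto simp: valid_def)
  moreover have "forces_source 0 {} G" by (simp add: forces_source_def)
  ultimately show ?case by (intro exI[of _ "{}"] exI[of _ G]) auto
next
  case (Suc t)
  then show ?case using forces_source_step by meson
qed

section \<open>A second-layer node that hears nothing\<close>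

text \<open>The bound on \<open>r\<close> is used twice: at most \<open>2 * r\<close> fixed
  components leave one free, and the \<open>r\<close> sets of would-be transmitters are fewer than
  the \<open>k\<close> nodes of its group.\<close>

lemma exists_uninformed:
  assumes \<pi>: "broadcast_protocol \<mu> \<pi>" and r: "2 * r < k"
  shows "\<exists>S. valid S \<and> (\<exists>i<k. \<forall>t<r. received \<pi> (edges S) t (z i) = None)"
proof -
  obtain C S where S: "valid S" and C: "C \<subseteq> {..<k}" "card C \<le> 2 * r" and force: "forces_source r C S"
    using exists_forces_source by blast
  have "card C < card {..<k}" using C r by simp
  then obtain i where i: "i < k" "i \<notin> C"
    using C(1) by (metis lessThan_iff psubset_imp_ex_mem psubsetI less_irrefl DiffE)
  \<comment> \<open>The source's actions are read off from \<open>S\<close>, before \<open>X\<close>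
    exists; since \<open>i \<notin> C\<close>, they stay correct after the edges of component
    \<open>i\<close> are changed. Every node is treated as if joined to \<open>z i\<close>, which is
    right for the nodes of \<open>X\<close>, the only ones \<open>z i\<close> can hear.\<close>
  define f where "f = history_source_only \<pi> (\<lambda>t. act S t 0) {0, z i}"
  have f_Suc: "f (Suc t) x = f t x @
      [if \<pi> x {0, z i} (f t x) = Receive \<and> is_Transmit (act S t 0)
       then Some (0, msg_of (act S t 0)) else None]" for t x
    by (simp add: f_def)
  define T where "T t = {x. is_Transmit (\<pi> x {0, z i} (f t x))}" for t
  have "card {..<r} < card (G i)" using r group[OF i(1)] by simp
  then obtain X where X: "X \<subseteq> G i" "X \<noteq> {}" "\<And>t. t < r \<Longrightarrow> \<not> (\<exists>!x. x \<in> X \<and> x \<in> T t)"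
    using exists_unselected_subset[of "{..<r}" "G i" T] group[OF i(1)]
    by (metis finite_lessThan lessThan_iff)
  define S' where "S' = S(i := X)"
  have v: "valid S'" unfolding S'_def using valid_update S X by blast
  have nbx: "edges S' `` {x} = {0, z i}" if "x \<in> X" for x
    using neighbours_group[OF v i(1), of x] that X(1) by (simp add: S'_def subset_iff)
  have nbz: "edges S' `` {z i} = X" using neighbours_z[OF v i(1)] by (simp add: S'_def)
  have src: "hist S' t 0 = hist S t 0" if "t \<le> r" for t
  proof -
    have "hist S' r 0 = hist S r 0"
      using force v i unfolding forces_source_def S'_def by auto
    then show ?thesis using history_eq_mono that by blast
  qed
  have recz: "reception (edges S') (act S' t) (z i) = None"
    if "t < r" and IH: "\<forall>x\<in>X. hist S' t x = f t x" for t
  proof -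
    have "(w \<in> edges S' `` {z i} \<and> is_Transmit (act S' t w)) = (w \<in> X \<and> w \<in> T t)" for w
      unfolding nbz using IH nbx by (auto simp: T_def)
    then show ?thesis using X(3)[OF that(1)] unfolding reception_def by auto
  qed
  \<comment> \<open>The two claims support each other: while \<open>z i\<close> has heard nothing it
    is silent, so \<open>X\<close> hears only the source as predicted; and while \<open>X\<close>
    follows the prediction, the choice of \<open>X\<close> never leaves exactly one transmitter next
    to \<open>z i\<close>.\<close>
  have main: "(\<forall>x\<in>X. hist S' t x = f t x) \<and> (\<forall>y\<in>set (hist S' t (z i)). y = None)" if "t \<le> r" for t
    using that
  proof (induction t)
    case 0
    then show ?case by (simp add: f_def)
  next
    case (Suc t)
    then have IH: "\<forall>x\<in>X. hist S' t x = f t x" "\<forall>y\<in>set (hist S' t (z i)). y = None" by auto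
    have quiet: "\<not> is_Transmit (act S' t (z i))"
      by (rule uninformed_silent[OF \<pi> IH(2) z_nonzero[OF i(1)]])
    have a0: "act S' t 0 = act S t 0" using act_source_cong[OF v S] src Suc.prems by simp
    have "hist S' (Suc t) x = f (Suc t) x" if x: "x \<in> X" for x
    proof -
      have hx: "hist S' t x = f t x" using IH(1) x by blast
      have rec: "reception (edges S') (act S' t) x =
        (if act S' t x = Receive \<and> is_Transmit (act S' t 0) then Some (0, msg_of (act S' t 0)) else None)"
        by (rule reception_single_sender) (use nbx[OF x] quiet in auto)
      show ?thesis unfolding history.simps rec f_Suc unfolding a0 hx nbx[OF x] by (rule refl)
    qed
    moreover have "reception (edges S') (act S' t) (z i) = None" using recz IH(1) Suc.prems by simp
    then have "\<forall>y\<in>set (hist S' (Suc t) (z i)). y = None"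
      using IH(2) unfolding history.simps set_append by simp
    ultimately show ?case by blast
  qed
  have "received \<pi> (edges S') t (z i) = None" if "t < r" for t
    unfolding received_def using recz main that by simp
  then show ?thesis using v i by blast
qed

lemma exists_slow_C2_network:
  assumes "broadcast_protocol \<mu> \<pi>" "2 \<le> k"
  shows "\<exists>V E. C2_network m k G z V E \<and> graph_radius V E = 2 \<and>
           (\<forall>t. 3 * t \<le> k \<longrightarrow> \<not> completes_broadcast \<mu> \<pi> V E t)"
proof -
  \<comment> \<open>One network, deaf at \<open>z i\<close> for \<open>k div 3\<close> rounds,
    serves every \<open>t\<close> with \<open>3 * t \<le> k\<close> at once.\<close>
  have "2 * (k div 3) < k" using assms(2) by linarith
  then obtain S i where S: "valid S" and i: "i < k"
    and deaf: "\<forall>t<k div 3. received \<pi> (edges S) t (z i) = None"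
    using exists_uninformed[OF assms(1)] by blast
  have "\<not> completes_broadcast \<mu> \<pi> (C2_nodes k G z) (edges S) t" if "3 * t \<le> k" for t
  proof -
    have "z i \<in> C2_nodes k G z - {0}" using i z_nonzero by (auto simp: C2_nodes_def)
    moreover have "received \<pi> (edges S) s (z i) = None" if "s < t" for s
      using deaf that \<open>3 * t \<le> k\<close> by simp
    ultimately show ?thesis unfolding completes_broadcast_def by (metis option.distinct(1))
  qed
  then show ?thesis using C2_network_edges[OF S] graph_radius_edges[OF S assms(2)] by blast
qed

end

end

section \<open>Asymptotic form of the lower bound\<close>

theorem theorem2:
  fixes \<mu> :: 'a and \<pi> :: "'a protocol"
    and m :: "nat \<Rightarrow> nat"
    and G :: "nat \<Rightarrow> nat \<Rightarrow> nat set" and z :: "nat \<Rightarrow> nat \<Rightarrow> nat"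
  assumes "broadcast_protocol \<mu> \<pi>"
    and "poly_bounded m"
    and "\<And>k. C2_labelling m k (G k) (z k)"
  shows "(\<forall>r :: nat \<Rightarrow> nat. (\<lambda>n. real (r n)) \<in> o(\<lambda>n. sqrt (real n)) \<longrightarrow>
           (\<forall>\<^sub>F k in sequentially. \<exists>V E. C2_network m k (G k) (z k) V E \<and>
              \<not> completes_broadcast \<mu> \<pi> V E (r (k\<^sup>2)))) \<and>
         (\<exists>c>0. \<forall>\<^sub>F k in sequentially. \<exists>V E. C2_network m k (G k) (z k) V E \<and>
            graph_radius V E = 2 \<and>
            (\<forall>t. real t \<le> c * sqrt (real (k\<^sup>2)) \<longrightarrow> \<not> completes_broadcast \<mu> \<pi> V E t))"
proof -
  have slow: "\<exists>V E. C2_network m k (G k) (z k) V E \<and> graph_radius V E = 2 \<and>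
      (\<forall>t. real t \<le> (1/3) * sqrt (real (k\<^sup>2)) \<longrightarrow> \<not> completes_broadcast \<mu> \<pi> V E t)"
    if "2 \<le> k" for k
  proof -
    interpret C2_family m k "G k" "z k" by unfold_locales (rule assms(3))
    have "3 * t \<le> k" if "real t \<le> (1/3) * sqrt (real (k\<^sup>2))" for t
      using that by simp
    then show ?thesis using exists_slow_C2_network[OF assms(1) that] by meson
  qed
  have "\<forall>\<^sub>F k in sequentially. \<exists>V E. C2_network m k (G k) (z k) V E \<and>
      \<not> completes_broadcast \<mu> \<pi> V E (r (k\<^sup>2))"
    if r: "(\<lambda>n. real (r n)) \<in> o(\<lambda>n. sqrt (real n))" for r :: "nat \<Rightarrow> nat"
  proof -
    \<comment> \<open>Little-o is instantiated with the constant 1/3 of \<open>slow\<close>, and the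
      bound is then restricted to perfect squares \<open>n\<close>.\<close>
    have "\<forall>\<^sub>F n in sequentially. real (r n) \<le> (1/3) * sqrt (real n)"
      using landau_o.smallD[OF r, of "1/3"] by simp
    moreover have "filterlim (\<lambda>k::nat. k\<^sup>2) sequentially sequentially"
      by (rule filterlim_at_top_mono[OF filterlim_ident]) (simp add: power2_eq_square)
    ultimately have "\<forall>\<^sub>F k in sequentially. real (r (k\<^sup>2)) \<le> (1/3) * sqrt (real (k\<^sup>2))"
      by (rule eventually_compose_filterlim)
    then show ?thesis
      using eventually_ge_at_top[of 2] by eventually_elim (use slow in meson)
  qed
  moreover have "\<forall>\<^sub>F k in sequentially. \<exists>V E. C2_network m k (G k) (z k) V E \<and>
      graph_radius V E = 2 \<and>
      (\<forall>t. real t \<le> (1/3) * sqrt (real (k\<^sup>2)) \<longrightarrow> \<not> completes_broadcast \<mu> \<pi> V E t)"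
    using eventually_ge_at_top[of 2] by eventually_elim (use slow in meson)
  then have "\<exists>c>0. \<forall>\<^sub>F k in sequentially. \<exists>V E. C2_network m k (G k) (z k) V E \<and>
      graph_radius V E = 2 \<and>
      (\<forall>t. real t \<le> c * sqrt (real (k\<^sup>2)) \<longrightarrow> \<not> completes_broadcast \<mu> \<pi> V E t)"
    by (intro exI[of _ "1/3"]) simp
  ultimately show ?thesis by blast
qed

end
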